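(* Let $A\in\mathbb{R}^{m\times n}$ with $m<n$, $\boldsymbol b\in\mathbb{R}^m$ with $\boldsymbol b\neq\mathbf 0$, $\alpha>0$, $\mu>0$. Let the initial point $(\widehat{\boldsymbol x}^0,\widehat{\boldsymbol\omega}^0)$ satisfy $\mathcal J_\mu(\widehat{\boldsymbol x}^0,\widehat{\boldsymbol\omega}^0)<\mathrm{spark}(A)$. Let $\{(\widehat{\boldsymbol x}^k,\widehat{\boldsymbol\omega}^k)\}_k$ denote the sequence generated from it by the noisy-case block coordinate descent algorithm (described in the context). Then the sequence $\{(\widehat{\boldsymbol x}^k,\widehat{\boldsymbol\omega}^k)\}_k$ is bounded and converges to the minimizer of the model $\min_{\boldsymbol x\in\mathbb{R}^n}\mathcal G_\mu(\boldsymbol x)$, where $\mathcal G_\mu(\boldsymbol x)=\tfrac\alpha2\|A\boldsymbol x-\boldsymbol b\|_2^2+\Phi_\mu(\boldsymbol x)$, in a finite number of steps.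
   Context: The truncated Huber function is $\phi_\mu(x)=\min(1,x^2/\mu^2)$ for $x\in\mathbb{R}$, and $\Phi_\mu(\boldsymbol x)=\sum_{i=1}^n\phi_\mu(\boldsymbol x_i)$. For $\boldsymbol x,\boldsymbol\omega\in\mathbb{R}^n$, $$\mathcal Q_\mu(\boldsymbol x,\boldsymbol\omega)=\tfrac1{\mu^2}\|(\mathbf 1-\boldsymbol\omega)\circ\boldsymbol x\|_2^2+\|\boldsymbol\omega\|_0,\qquad \mathcal J_\mu(\boldsymbol x,\boldsymbol\omega)=\tfrac\alpha2\|A\boldsymbol x-\boldsymbol b\|_2^2+\mathcal Q_\mu(\boldsymbol x,\boldsymbol\omega),$$ where $\circ$ is the entrywise product, $\mathbf 1$ the all-ones vector and $\|\cdot\|_0$ the number of non-zero entries. The model $\min_{\boldsymbol x}\mathcal G_\mu(\boldsymbol x)$ is treated through its bivariate reformulation $\min_{\boldsymbol x,\boldsymbol\omega}\mathcal J_\mu(\boldsymbol x,\boldsymbol\omega)$, so that the iterates are pairs $(\boldsymbol x,\boldsymbol\omega)$ with $\boldsymbol\omega$ an auxiliary variable. The operator $\mathcal H_\mu$ is defined componentwise by $(\mathcal H_\mu(\boldsymbol x))_i=0$ if $|\boldsymbol x_i|\le\mu$ and $1$ if $|\boldsymbol x_i|>\mu$. $\mathrm{spark}(A)=\min\{\|\boldsymbol v\|_0:\boldsymbol v\ne\mathbf 0,\ A\boldsymbol v=\mathbf 0\}$ is the smallest number of linearly dependent columns of $A$. Noisy-case block coordinate descent algorithm: starting from $(\widehat{\boldsymbol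 x}^0,\widehat{\boldsymbol\omega}^0)$, for $j=0,1,2,\dots$ set $$\widehat{\boldsymbol x}^{j+1}\in\arg\min_{\boldsymbol x}\mathcal J_\mu(\boldsymbol x,\widehat{\boldsymbol\omega}^j),\qquad \widehat{\boldsymbol\omega}^{j+1}\in\arg\min_{\boldsymbol\omega}\mathcal Q_\mu(\widehat{\boldsymbol x}^{j+1},\boldsymbol\omega),$$ computed as follows. According to the binary vector $\widehat{\boldsymbol\omega}^j$, partition the indices into $\mathcal I_1=\{i:\widehat{\boldsymbol\omega}^j_i=1\}$ and $\mathcal I_2=\{i:\widehat{\boldsymbol\omega}^j_i=0\}$, let $A_{\mathcal I}$ be the submatrix of columns of $A$ indexed by $\mathcal I$, and let $M=\tfrac1\alpha I+\tfrac{\mu^2}{2}A_{\mathcal I_2}A_{\mathcal I_2}^\top$, with $I$ the identity matrix. Then $$\widehat{\boldsymbol x}^{j+1}_{\mathcal I_1}=(A_{\mathcal I_1}^\top M^{-1}A_{\mathcal I_1})^{-1}A_{\mathcal I_1}^\top M^{-1}\boldsymbol b,\quad \widehat{\boldsymbol y}^{j+1}=M^{-1}(A_{\mathcal I_1}\widehat{\boldsymbol x}^{j+1}_{\mathcal I_1}-\boldsymbol b),\quad \widehat{\boldsymbol x}^{j+1}_{\mathcal I_2}=-\tfrac{\mu^2}{2}A_{\mathcal I_2}^\top\widehat{\boldsymbol y}^{j+1},$$ and $\widehat{\boldsymbol\omega}^{j+1}=\mathcal H_\mu(\widehat{\boldsymbol x}^{j+1})$.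
   Formalization: "The minimizer of the model" is false globally; proved instead: the limit pair is a strict local minimizer of J, each block globally optimal given the other, G=J there, and x is a strict local minimizer of G if no entry has modulus μ. The initial ω is taken binary. *)

theory Defs
  imports "HOL-Analysis.Analysis"
begin

definition norm0 :: "real ^ 'n \<Rightarrow> nat" where
  "norm0 x = card {i. x $ i \<noteq> 0}"

text \<open>The set is nonempty whenever the matrix has more columns than rows.\<close>

definition spark :: "real ^ 'n ^ 'm \<Rightarrow> nat" where
  "spark A = Inf {norm0 v | v. v \<noteq> 0 \<and> A *v v = 0}"

definition trunc_huber :: "real \<Rightarrow> real \<Rightarrow> real" where
  "trunc_huber \<mu> t = min 1 (t\<^sup>2 / \<mu>\<^sup>2)"

definition Phi :: "real \<Rightarrow> real ^ 'n \<Rightarrow> real" where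
  "Phi \<mu> x = (\<Sum>i\<in>UNIV. trunc_huber \<mu> (x $ i))"

definition G_obj :: "real ^ 'n ^ 'm \<Rightarrow> real ^ 'm \<Rightarrow> real \<Rightarrow> real \<Rightarrow> real ^ 'n \<Rightarrow> real" where
  "G_obj A b \<alpha> \<mu> x = \<alpha> / 2 * (norm (A *v x - b))\<^sup>2 + Phi \<mu> x"

text \<open>On vectors, \<open>1\<close> is the all-ones vector and \<open>*\<close> is the entrywise product.\<close>

definition Q_obj :: "real \<Rightarrow> real ^ 'n \<Rightarrow> real ^ 'n \<Rightarrow> real" where
  "Q_obj \<mu> x \<omega> = 1 / \<mu>\<^sup>2 * (norm ((1 - \<omega>) * x))\<^sup>2 + real (norm0 \<omega>)"

definition J_obj ::
  "real ^ 'n ^ 'm \<Rightarrow> real ^ 'm \<Rightarrow> real \<Rightarrow> real \<Rightarrow> real ^ 'n \<Rightarrow> real ^ 'n \<Rightarrow> real" where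
  "J_obj A b \<alpha> \<mu> x \<omega> = \<alpha> / 2 * (norm (A *v x - b))\<^sup>2 + Q_obj \<mu> x \<omega>"

definition H_op :: "real \<Rightarrow> real ^ 'n \<Rightarrow> real ^ 'n" where
  "H_op \<mu> x = (\<chi> i. if \<bar>x $ i\<bar> \<le> \<mu> then 0 else 1)"

definition binary_vec :: "real ^ 'n \<Rightarrow> bool" where
  "binary_vec \<omega> \<longleftrightarrow> (\<forall>i. \<omega> $ i = 0 \<or> \<omega> $ i = 1)"

text \<open>Objects indexed by a subset \<open>I\<close> of the column indices are padded with zeros to the full
  index type.  The column submatrix \<open>A\<^sub>I\<close> keeps the columns in \<open>I\<close> and has zero columns elsewhere;
  this does not affect products such as \<open>A\<^sub>I A\<^sub>I\<^sup>T\<close> or \<open>A\<^sub>I x\<^sub>I\<close>.\<close>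

definition col_sub :: "'n set \<Rightarrow> real ^ 'n ^ 'm \<Rightarrow> real ^ 'n ^ 'm" where
  "col_sub I A = (\<chi> i j. if j \<in> I then A $ i $ j else 0)"

definition mat_on :: "'n set \<Rightarrow> real ^ 'n ^ 'n" where
  "mat_on I = (\<chi> i j. if i = j \<and> i \<in> I then 1 else 0)"

text \<open>The zero-padded inverse of an \<open>I \<times> I\<close> matrix \<open>K\<close> that is itself zero-padded: the two-sided
  inverse with respect to the identity of the \<open>I \<times> I\<close> block.  As for \<open>matrix_inv\<close>, its value is
  unspecified when the block is singular.\<close>

definition block_inv :: "'n set \<Rightarrow> real ^ 'n ^ 'n \<Rightarrow> real ^ 'n ^ 'n" where
  "block_inv I K = (SOME L. (\<forall>i j. i \<notin> I \<or> j \<notin> I \<longrightarrow> L $ i $ j = 0)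
     \<and> K ** L = mat_on I \<and> L ** K = mat_on I)"

text \<open>The two padded blocks \<open>x1\<close> and \<open>x2\<close> have disjoint supports, so their sum assembles the
  new iterate.\<close>

definition bcd_x_update ::
  "real ^ 'n ^ 'm \<Rightarrow> real ^ 'm \<Rightarrow> real \<Rightarrow> real \<Rightarrow> real ^ 'n \<Rightarrow> real ^ 'n" where
  "bcd_x_update A b \<alpha> \<mu> \<omega> =
    (let I1 = {i. \<omega> $ i = 1};
         I2 = {i. \<omega> $ i = 0};
         A1 = col_sub I1 A;
         A2 = col_sub I2 A;
         M = (1 / \<alpha>) *\<^sub>R mat 1 + (\<mu>\<^sup>2 / 2) *\<^sub>R (A2 ** transpose A2);
         Mi = matrix_inv M;
         x1 = block_inv I1 (transpose A1 ** Mi ** A1) *v (transpose A1 *v (Mi *v b));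
         y = Mi *v (A1 *v x1 - b);
         x2 = - (\<mu>\<^sup>2 / 2) *\<^sub>R (transpose A2 *v y)
     in x1 + x2)"

definition bcd_step ::
  "real ^ 'n ^ 'm \<Rightarrow> real ^ 'm \<Rightarrow> real \<Rightarrow> real \<Rightarrow>
   (real ^ 'n) \<times> (real ^ 'n) \<Rightarrow> (real ^ 'n) \<times> (real ^ 'n)" where
  "bcd_step A b \<alpha> \<mu> z =
    (let x' = bcd_x_update A b \<alpha> \<mu> (snd z) in (x', H_op \<mu> x'))"

definition bcd_seq ::
  "real ^ 'n ^ 'm \<Rightarrow> real ^ 'm \<Rightarrow> real \<Rightarrow> real \<Rightarrow>
   (real ^ 'n) \<times> (real ^ 'n) \<Rightarrow> nat \<Rightarrow> (real ^ 'n) \<times> (real ^ 'n)" where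
  "bcd_seq A b \<alpha> \<mu> z0 k = (bcd_step A b \<alpha> \<mu> ^^ k) z0"

text \<open>The punctured filter \<open>at z\<close> makes the minimizer the only one in some neighbourhood.\<close>

definition strict_local_minimizer :: "('a::topological_space \<Rightarrow> real) \<Rightarrow> 'a \<Rightarrow> bool" where
  "strict_local_minimizer f z \<longleftrightarrow> (\<forall>\<^sub>F y in at z. f z < f y)"

text \<open>The sense in which a pair solves the nonconvex model \<open>min G\<close> through its reformulation
  \<open>min J\<close>.  A block coordinate method can stop at a minimizer of \<open>J\<close> that is not global, so
  minimality over pairs is local, while each block is globally optimal given the other.  The
  restriction in the last clause is needed: \<open>G\<close> has a concave kink where an entry has
  modulus \<open>\<mu>\<close>, and the method may stop there.\<close>

definition model_minimizer ::
  "real ^ 'n ^ 'm \<Rightarrow> real ^ 'm \<Rightarrow> real \<Rightarrow> real \<Rightarrow> real ^ 'n \<Rightarrow> real ^ 'n \<Rightarrow> bool" where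
  "model_minimizer A b \<alpha> \<mu> x \<omega> \<longleftrightarrow>
     strict_local_minimizer (\<lambda>(u, v). J_obj A b \<alpha> \<mu> u v) (x, \<omega>)
   \<and> is_arg_min (\<lambda>u. J_obj A b \<alpha> \<mu> u \<omega>) (\<lambda>_. True) x
   \<and> is_arg_min (\<lambda>v. J_obj A b \<alpha> \<mu> x v) (\<lambda>_. True) \<omega>
   \<and> G_obj A b \<alpha> \<mu> x = J_obj A b \<alpha> \<mu> x \<omega>
   \<and> ((\<forall>i. \<bar>x $ i\<bar> \<noteq> \<mu>) \<longrightarrow> strict_local_minimizer (G_obj A b \<alpha> \<mu>) x)"

end

theory Submission
  imports Defs
begin

text \<open>
  For a binary \<open>\<omega>\<close> with fewer than \<open>spark A\<close> ones, \<open>J(\<sqdot>, \<omega>)\<close> is a strictly convex quadratic: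
  its quadratic part vanishes only on kernel vectors of \<open>A\<close> supported where \<open>\<omega> = 1\<close>, and the spark
  leaves no such vector but \<open>0\<close>.  The closed formula of the x-update solves the normal equations
  (\<open>bcd_x_update_stationary\<close>), so it yields the unique minimizer, with strict decrease of
  \<open>J\<close> from any other point (\<open>bcd_x_update_minimizes\<close>).  The thresholding \<open>H\<close> minimizes
  \<open>J(x, \<sqdot>)\<close>, and the minimum is \<open>G x\<close> (\<open>J_obj_H_op\<close>, \<open>G_obj_le_J_obj\<close>).
  Hence \<open>J\<close> never increases along the iteration.  As \<open>J\<close> dominates the number of ones
  of \<open>\<omega>\<close>, the bound on the initial value keeps every \<open>\<omega>\<close> of the iteration that sparse.

  Termination is a counting argument.  The value \<open>J(x\<^sub>k\<^sub>+\<^sub>1, \<omega>\<^sub>k)\<close> is the minimum of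
  \<open>J(\<sqdot>, \<omega>\<^sub>k)\<close>, hence a function of the binary vector \<open>\<omega>\<^sub>k\<close>, of which there are finitely many;
  a nonincreasing sequence with finitely many values repeats a value at consecutive indices.  Strict
  decrease off the unique minimizer turns this equality of values into equality of the
  x-iterates, so a fixed point of the iteration has been reached.

  At a fixed point \<open>(x, \<omega>)\<close> both blocks are optimal, the x-block uniquely, and this gives a strict local
  minimum of \<open>J\<close> (\<open>J_obj_strict_local_minimizer\<close>): a small perturbation of \<open>\<omega>\<close> cannot lose a nonzero
  entry, gaining one costs a full unit, and with the support unchanged the unique minimality in \<open>x\<close>
  decides.  If no entry of \<open>x\<close> has modulus \<open>\<mu>\<close>, then \<open>H\<close> is constant near \<open>x\<close>, so that
  \<open>G = J(\<sqdot>, \<omega>)\<close> there.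
\<close>

section \<open>Zero-padded blocks\<close>

lemma mat_on_mult_vec: "(mat_on I *v v) $ i = (if i \<in> I then v $ i else 0)"
proof -
  have "(mat_on I *v v) $ i = (\<Sum>j\<in>UNIV. if j = i then (if i \<in> I then v $ j else 0) else 0)"
    unfolding matrix_vector_mult_def mat_on_def vec_lambda_beta
    by (intro sum.cong refl) simp
  then show ?thesis by simp
qed

text \<open>
  The choice in \<open>block_inv\<close> succeeds because a padded \<open>K\<close> with nonsingular block becomes invertible
  once the identity is placed on the complementary block: \<open>K + Q\<close>.  Its inverse \<open>N\<close>
  commutes with the projection \<open>P\<close> onto the coordinates in \<open>I\<close>, so \<open>N ** P\<close> is the padded inverse.
\<close>

lemma block_inv_correct:
  fixes K :: "real ^ 'n ^ 'n"
  assumes padded: "\<And>i j. i \<notin> I \<or> j \<notin> I \<Longrightarrow> K $ i $ j = 0"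
    and inj: "\<And>v. \<lbrakk>\<And>i. i \<notin> I \<Longrightarrow> v $ i = 0; K *v v = 0\<rbrakk> \<Longrightarrow> v = 0"
  shows "K ** block_inv I K = mat_on I" and "\<And>i j. i \<notin> I \<Longrightarrow> block_inv I K $ i $ j = 0"
proof -
  define P Q :: "real ^ 'n ^ 'n" where "P = mat_on I" and "Q = mat_on (- I)"
  have K_off: "(K *v v) $ i = 0" if "i \<notin> I" for v i
    using that by (simp add: matrix_vector_mult_def padded)
  have "v = 0" if "(K + Q) *v v = 0" for v
  proof -
    have eq: "(K *v v) $ i + (Q *v v) $ i = 0" for i
      using that by (metis matrix_vector_mult_add_rdistrib vector_add_component zero_index)
    have off: "v $ i = 0" if "i \<notin> I" for i
      using eq[of i] K_off[OF that] that by (simp add: Q_def mat_on_mult_vec)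
    have "(K *v v) $ i = 0" for i
      using eq[of i] K_off[of i v] by (cases "i \<in> I") (simp_all add: Q_def mat_on_mult_vec)
    then have "K *v v = 0" by (simp add: vec_eq_iff)
    with off show ?thesis by (rule inj)
  qed
  then have "invertible (K + Q)"
    using matrix_left_invertible_ker invertible_left_inverse by metis
  then obtain N where N: "(K + Q) ** N = mat 1" "N ** (K + Q) = mat 1"
    unfolding invertible_def by blast
  have KP: "K *v (P *v v) = K *v v" for v
    by (auto simp: vec_eq_iff matrix_vector_mult_def[of K] P_def mat_on_mult_vec padded
        intro!: sum.cong)
  have PK: "P *v (K *v v) = K *v v" for v
    by (simp add: vec_eq_iff P_def mat_on_mult_vec K_off)
  have right: "(K + Q) ** P = K" and left: "P ** (K + Q) = K"
    unfolding matrix_eq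
    by (simp_all add: matrix_vector_mult_add_rdistrib matrix_vector_right_distrib KP PK
        flip: matrix_vector_mul_assoc) (simp_all add: vec_eq_iff P_def Q_def mat_on_mult_vec)
  have PP: "P ** P = P"
    unfolding matrix_eq
    by (simp add: vec_eq_iff P_def mat_on_mult_vec flip: matrix_vector_mul_assoc)
  have comm: "N ** P = P ** N"
    by (metis N left right matrix_mul_assoc matrix_mul_lid matrix_mul_rid)
  have "K ** (N ** P) = P"
    by (metis N(1) PP left matrix_mul_assoc matrix_mul_rid)
  moreover have "(N ** P) ** K = P"
    by (metis N(2) PP comm right matrix_mul_assoc matrix_mul_lid)
  moreover have "(N ** P) $ i $ j = 0" if "i \<notin> I \<or> j \<notin> I" for i j
  proof (cases "i \<in> I")
    case True
    with that show ?thesis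
      by (auto simp: matrix_matrix_mult_def P_def mat_on_def intro!: sum.neutral)
  next
    case False
    then show ?thesis unfolding comm by (simp add: matrix_matrix_mult_def P_def mat_on_def)
  qed
  ultimately have "\<exists>L. (\<forall>i j. i \<notin> I \<or> j \<notin> I \<longrightarrow> L $ i $ j = 0) \<and> K ** L = mat_on I \<and> L ** K = mat_on I"
    unfolding P_def by blast
  from someI_ex[OF this] show "K ** block_inv I K = mat_on I"
    and "\<And>i j. i \<notin> I \<Longrightarrow> block_inv I K $ i $ j = 0"
    unfolding block_inv_def by blast+
qed

lemma col_sub_transpose_mult:
  "(transpose (col_sub I A) *v y) $ i = (if i \<in> I then (transpose A *v y) $ i else 0)"
  by (simp add: matrix_vector_mult_def transpose_def col_sub_def)

lemma col_sub_mult: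
  assumes "\<And>i. i \<notin> I \<Longrightarrow> v $ i = 0"
  shows "col_sub I A *v v = A *v v"
  using assms by (auto simp: vec_eq_iff matrix_vector_mult_def col_sub_def intro!: sum.cong)

section \<open>The normal equations of the x-update\<close>

lemma inner_transpose_mult:
  fixes A :: "real ^ 'n ^ 'm"
  shows "y \<bullet> (A *v d) = (transpose A *v y) \<bullet> d"
  by (simp add: dot_lmul_matrix flip: vector_transpose_matrix)

lemma kernel_vector_eq_0:
  assumes "A *v v = 0" and "norm0 v < spark A"
  shows "v = 0"
proof (rule ccontr)
  assume "v \<noteq> 0"
  with assms(1) have "spark A \<le> norm0 v"
    unfolding spark_def by (intro cInf_lower) auto
  with assms(2) show False by simp
qed

text \<open>
  How the spark enters: the columns of \<open>A\<close> selected by the support of a vector \<open>w\<close>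
  with \<open>norm0 w < spark A\<close> are linearly independent.
\<close>

lemma kernel_vector_eq_0_of_support:
  fixes w :: "real ^ 'n"
  assumes "A *v v = 0" and "norm0 w < spark A" and "\<And>i. w $ i = 0 \<Longrightarrow> v $ i = 0"
  shows "v = 0"
proof (rule kernel_vector_eq_0)
  have "norm0 v \<le> norm0 w"
    unfolding norm0_def using assms(3) by (intro card_mono) auto
  with assms(2) show "norm0 v < spark A" by simp
qed (fact assms(1))

lemma matrix_inv_right:
  fixes M :: "real ^ 'm ^ 'm"
  assumes "invertible M"
  shows "M ** matrix_inv M = mat 1"
  using someI_ex[OF assms[unfolded invertible_def]] unfolding matrix_inv_def by blast

text \<open>
  The quadratic form of \<open>M\<close> is \<open>c (w \<bullet> w)\<close> plus \<open>d\<close> times the squared norm of \<open>B\<^sup>T w\<close>, hence definite;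
  that of the inverse is definite too, as its value at \<open>z = M w\<close> is the value of the form of \<open>M\<close>
  at \<open>w\<close>.
\<close>

lemma regularized_gram_pos_def:
  fixes B :: "real ^ 'n ^ 'm"
  assumes "c > 0" "d \<ge> 0"
  defines "M \<equiv> c *\<^sub>R mat 1 + d *\<^sub>R (B ** transpose B)"
  shows "invertible M" and "z \<bullet> (matrix_inv M *v z) = 0 \<Longrightarrow> z = 0"
proof -
  have Mv: "M *v w = c *\<^sub>R w + d *\<^sub>R (B *v (transpose B *v w))" for w
    by (simp add: M_def matrix_vector_mult_add_rdistrib
        flip: scaleR_matrix_vector_assoc matrix_vector_mul_assoc)
  have quad: "w \<bullet> (M *v w) = c * (w \<bullet> w) + d * ((transpose B *v w) \<bullet> (transpose B *v w))" for w
    by (simp add: Mv inner_add_right inner_transpose_mult)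
  have pd: "w = 0" if "w \<bullet> (M *v w) = 0" for w
  proof -
    have "d * ((transpose B *v w) \<bullet> (transpose B *v w)) \<ge> 0" using assms(2) by simp
    moreover have "c * (w \<bullet> w) \<ge> 0" using assms(1) by simp
    ultimately have "c * (w \<bullet> w) = 0" using that quad[of w] by linarith
    with assms(1) show ?thesis by simp
  qed
  then have "\<And>w. M *v w = 0 \<Longrightarrow> w = 0" by simp
  then show inv: "invertible M"
    using matrix_left_invertible_ker invertible_left_inverse by metis
  assume z: "z \<bullet> (matrix_inv M *v z) = 0"
  have Mz: "M *v (matrix_inv M *v z) = z"
    by (simp add: matrix_vector_mul_assoc matrix_inv_right inv)
  with z have "matrix_inv M *v z = 0"
    by (intro pd) (simp add: inner_commute)
  with Mz show "z = 0" by simp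
qed

text \<open>
  The conclusion says that the gradient of \<open>J(\<sqdot>, \<omega>)\<close> vanishes at \<open>x\<close>.  The auxiliary \<open>y\<close> of the
  update is the scaled residual \<open>\<alpha> (A x - b)\<close>: this is what \<open>M y = A\<^sub>1 x\<^sub>1 - b\<close> says, because the
  second summand of \<open>M y\<close> is \<open>- A\<^sub>2 x\<^sub>2\<close>.  On the columns with \<open>\<omega> = 1\<close> the formula for
  \<open>x\<^sub>1\<close> makes \<open>A\<^sub>1\<^sup>T y\<close> zero; on the others the definition of \<open>x\<^sub>2\<close> expresses \<open>A\<^sub>2\<^sup>T y\<close> as
  a multiple of \<open>x\<^sub>2\<close>.
\<close>

lemma bcd_x_update_stationary:
  fixes A :: "real ^ 'n ^ 'm" and b :: "real ^ 'm" and \<omega> :: "real ^ 'n"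
  assumes "\<alpha> > 0" "\<mu> > 0" "binary_vec \<omega>" "norm0 \<omega> < spark A"
  defines "x \<equiv> bcd_x_update A b \<alpha> \<mu> \<omega>"
  shows "\<alpha> *\<^sub>R (transpose A *v (A *v x - b)) = - (2 / \<mu>\<^sup>2) *\<^sub>R ((1 - \<omega>) * x)"
proof -
  define I1 I2 where "I1 = {i. \<omega> $ i = 1}" and "I2 = {i. \<omega> $ i = 0}"
  define A1 A2 where "A1 = col_sub I1 A" and "A2 = col_sub I2 A"
  define M where "M = (1 / \<alpha>) *\<^sub>R mat 1 + (\<mu>\<^sup>2 / 2) *\<^sub>R (A2 ** transpose A2)"
  define Mi where "Mi = matrix_inv M"
  define K where "K = transpose A1 ** Mi ** A1"
  define c where "c = transpose A1 *v (Mi *v b)"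
  define x1 where "x1 = block_inv I1 K *v c"
  define y where "y = Mi *v (A1 *v x1 - b)"
  define x2 where "x2 = - (\<mu>\<^sup>2 / 2) *\<^sub>R (transpose A2 *v y)"
  have x: "x = x1 + x2"
    unfolding x_def bcd_x_update_def Let_def x1_def x2_def y_def c_def K_def Mi_def M_def
      A1_def A2_def I1_def I2_def ..
  have I: "i \<in> I2 \<longleftrightarrow> i \<notin> I1" for i
    using assms(3) unfolding binary_vec_def I1_def I2_def by fastforce
  have "1 / \<alpha> > 0" "\<mu>\<^sup>2 / 2 \<ge> 0" using assms(1) by simp_all
  note gram = regularized_gram_pos_def[OF this, where B = A2, folded M_def, folded Mi_def]
  note M_inv = gram(1) and M_pd = gram(2)
  have M_Mi: "M *v (Mi *v z) = z" for z
    using M_inv by (simp add: Mi_def matrix_vector_mul_assoc matrix_inv_right)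
  have K_mult: "K *v v = transpose A1 *v (Mi *v (A1 *v v))" for v
    by (simp add: K_def matrix_vector_mul_assoc matrix_mul_assoc)
  have K_padded: "K $ i $ j = 0" if "i \<notin> I1 \<or> j \<notin> I1" for i j
    using that by (auto simp: K_def A1_def matrix_matrix_mult_def transpose_def col_sub_def)
  \<comment> \<open>\<open>v \<bullet> K v\<close> is the form of the inverse of \<open>M\<close> at \<open>A\<^sub>1 v\<close>, so a kernel vector of the block of \<open>K\<close>
    is a kernel vector of \<open>A\<close> supported in \<open>I1\<close>.\<close>
  have K_inj: "v = 0" if v: "\<And>i. i \<notin> I1 \<Longrightarrow> v $ i = 0" "K *v v = 0" for v
  proof -
    have "(A1 *v v) \<bullet> (Mi *v (A1 *v v)) = v \<bullet> (K *v v)"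
      by (metis K_mult inner_commute inner_transpose_mult)
    then have "A1 *v v = 0" using v(2) by (intro M_pd) simp
    then have "A *v v = 0" using v(1) by (simp add: A1_def col_sub_mult)
    then show "v = 0"
      using assms(4) v(1) by (rule kernel_vector_eq_0_of_support) (simp add: I1_def)
  qed
  have K_block: "K ** block_inv I1 K = mat_on I1"
    and block_inv_off: "\<And>i j. i \<notin> I1 \<Longrightarrow> block_inv I1 K $ i $ j = 0"
    by (rule block_inv_correct; blast intro: K_padded K_inj)+
  have "c $ i = 0" if "i \<notin> I1" for i
    using that by (simp only: c_def A1_def col_sub_transpose_mult if_False)
  then have "K *v x1 = c"
    by (simp add: x1_def matrix_vector_mul_assoc K_block vec_eq_iff mat_on_mult_vec)
  moreover have "transpose A1 *v y = K *v x1 - c"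
    by (simp only: y_def matrix_vector_mult_diff_distrib K_mult c_def)
  ultimately have A1y: "transpose A1 *v y = 0" by simp
  have x1_off: "x1 $ i = 0" if "i \<notin> I1" for i
    using that by (simp add: x1_def matrix_vector_mult_def block_inv_off)
  have x2_nth: "x2 $ i = - (\<mu>\<^sup>2 / 2) * (if i \<in> I2 then (transpose A *v y) $ i else 0)" for i
    by (simp only: x2_def A2_def vector_scaleR_component col_sub_transpose_mult real_scaleR_def)
  have x2_off: "x2 $ i = 0" if "i \<in> I1" for i
    using that I by (simp add: x2_nth)
  have "A1 *v x1 = A *v x1" "A2 *v x2 = A *v x2"
    unfolding A1_def A2_def using x1_off x2_off I by (blast intro: col_sub_mult)+
  then have "A *v x - b = (A1 *v x1 - b) + A2 *v x2"
    by (simp add: x matrix_vector_right_distrib)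
  also have "A1 *v x1 - b = M *v y"
    by (simp add: y_def M_Mi)
  also have "A2 *v x2 = - (\<mu>\<^sup>2 / 2) *\<^sub>R (A2 *v (transpose A2 *v y))"
    unfolding x2_def by (rule matrix_vector_mult_scaleR)
  also have "M *v y = (1 / \<alpha>) *\<^sub>R y + (\<mu>\<^sup>2 / 2) *\<^sub>R (A2 *v (transpose A2 *v y))"
    by (simp add: M_def matrix_vector_mult_add_rdistrib
        flip: scaleR_matrix_vector_assoc matrix_vector_mul_assoc)
  finally have "A *v x - b = (1 / \<alpha>) *\<^sub>R y" by simp
  then have residual: "\<alpha> *\<^sub>R (transpose A *v (A *v x - b)) = transpose A *v y"
    using assms(1) by (simp only: matrix_vector_mult_scaleR) simp
  have "(transpose A *v y) $ i = (- (2 / \<mu>\<^sup>2) *\<^sub>R ((1 - \<omega>) * x)) $ i" for i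
  proof (cases "i \<in> I1")
    case True
    then have "(transpose A *v y) $ i = 0"
      using A1y by (metis A1_def col_sub_transpose_mult zero_index)
    with True show ?thesis by (simp add: I1_def)
  next
    case False
    then have "x $ i = - (\<mu>\<^sup>2 / 2) * (transpose A *v y) $ i"
      using I by (simp add: x x1_off x2_nth)
    moreover have "\<omega> $ i = 0" using False I by (simp add: I2_def)
    ultimately show ?thesis using assms(2) by simp
  qed
  then show ?thesis unfolding residual by (simp add: vec_eq_iff)
qed

section \<open>The two partial minimizations\<close>

text \<open>
  Second-order expansion around a stationary point: stationarity cancels the linear term.  Binarity
  of \<open>\<omega>\<close> makes the weights satisfy \<open>(1 - \<omega>)\<^sup>2 = 1 - \<omega>\<close>, so the gradient of the coupling term needs
  only one factor \<open>1 - \<omega>\<close>.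
\<close>

lemma J_obj_increment:
  assumes "binary_vec \<omega>"
    and "\<alpha> *\<^sub>R (transpose A *v (A *v x - b)) = - (2 / \<mu>\<^sup>2) *\<^sub>R ((1 - \<omega>) * x)"
  shows "J_obj A b \<alpha> \<mu> u \<omega> - J_obj A b \<alpha> \<mu> x \<omega>
    = \<alpha> / 2 * (norm (A *v (u - x)))\<^sup>2 + 1 / \<mu>\<^sup>2 * (norm ((1 - \<omega>) * (u - x)))\<^sup>2"
proof -
  define d where "d = u - x"
  define r where "r = A *v x - b"
  define p where "p = (1 - \<omega>) * x"
  define q where "q = (1 - \<omega>) * d"
  have u: "A *v u - b = r + A *v d" "(1 - \<omega>) * u = p + q"
    by (simp_all add: d_def r_def p_def q_def algebra_simps)
  have "\<omega> $ i = 0 \<or> \<omega> $ i = 1" for i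
    using assms(1) by (simp add: binary_vec_def)
  then have pq: "p \<bullet> q = p \<bullet> d"
    unfolding inner_vec_def p_def q_def by (intro sum.cong refl) fastforce
  have "\<alpha> * (r \<bullet> (A *v d)) = (\<alpha> *\<^sub>R (transpose A *v r)) \<bullet> d"
    by (simp add: inner_transpose_mult)
  also have "\<dots> = - (2 / \<mu>\<^sup>2) * (p \<bullet> q)"
    using assms(2) by (simp add: r_def[symmetric] p_def[symmetric] pq)
  finally have cross: "\<alpha> * (r \<bullet> (A *v d)) = - (2 / \<mu>\<^sup>2) * (p \<bullet> q)" .
  have sq: "(norm (v + w))\<^sup>2 = (norm v)\<^sup>2 + 2 * (v \<bullet> w) + (norm w)\<^sup>2" for v w :: "'z::real_inner"
    by (simp add: power2_norm_eq_inner inner_add_left inner_add_right inner_commute)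
  show ?thesis
    unfolding J_obj_def Q_obj_def d_def[symmetric] u r_def[symmetric] p_def[symmetric]
      q_def[symmetric] sq
    using cross by (simp add: algebra_simps)
qed

text \<open>
  The increment vanishes only if the displacement lies in the kernel of \<open>A\<close> and is supported where
  \<open>\<omega> = 1\<close>, and then the spark forces it to be \<open>0\<close>.  The strict form is what makes the iteration stop.
\<close>

lemma bcd_x_update_minimizes:
  fixes A :: "real ^ 'n ^ 'm"
  assumes "\<alpha> > 0" "\<mu> > 0" "binary_vec \<omega>" "norm0 \<omega> < spark A"
    and "u \<noteq> bcd_x_update A b \<alpha> \<mu> \<omega>"
  shows "J_obj A b \<alpha> \<mu> (bcd_x_update A b \<alpha> \<mu> \<omega>) \<omega> < J_obj A b \<alpha> \<mu> u \<omega>"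
proof -
  define d where "d = u - bcd_x_update A b \<alpha> \<mu> \<omega>"
  have inc: "J_obj A b \<alpha> \<mu> u \<omega> - J_obj A b \<alpha> \<mu> (bcd_x_update A b \<alpha> \<mu> \<omega>) \<omega>
    = \<alpha> / 2 * (norm (A *v d))\<^sup>2 + 1 / \<mu>\<^sup>2 * (norm ((1 - \<omega>) * d))\<^sup>2"
    unfolding d_def using assms by (intro J_obj_increment bcd_x_update_stationary)
  have "A *v d \<noteq> 0 \<or> (1 - \<omega>) * d \<noteq> 0"
  proof (rule ccontr)
    assume "\<not> ?thesis"
    then have "A *v d = 0" and off: "(1 - \<omega>) * d = 0" by auto
    have "d $ i = 0" if "\<omega> $ i = 0" for i
      using arg_cong[OF off, of "\<lambda>v. v $ i"] that by simp
    then have "d = 0"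
      by (rule kernel_vector_eq_0_of_support[OF \<open>A *v d = 0\<close> assms(4)])
    with assms(5) show False by (simp add: d_def)
  qed
  then have "\<alpha> / 2 * (norm (A *v d))\<^sup>2 + 1 / \<mu>\<^sup>2 * (norm ((1 - \<omega>) * d))\<^sup>2 > 0"
    using assms(1,2) by (auto intro: add_pos_nonneg add_nonneg_pos)
  with inc show ?thesis by linarith
qed

lemma Q_obj_eq_sum:
  "Q_obj \<mu> x \<omega> = (\<Sum>i\<in>UNIV. ((1 - \<omega> $ i) * x $ i)\<^sup>2 / \<mu>\<^sup>2 + (if \<omega> $ i \<noteq> 0 then 1 else 0))"
  unfolding Q_obj_def norm0_def
  by (simp add: sum.distrib power2_norm_eq_inner inner_vec_def sum_divide_distrib sum.If_cases
      flip: power2_eq_square)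

text \<open>
  A nonzero \<open>w\<close> already costs the cap \<open>1\<close> of the truncated Huber function, and \<open>w = 0\<close> leaves the
  quadratic branch.
\<close>

lemma trunc_huber_le_coupling:
  "trunc_huber \<mu> t \<le> ((1 - w) * t)\<^sup>2 / \<mu>\<^sup>2 + (if w \<noteq> 0 then 1 else 0)"
  by (simp add: trunc_huber_def) (simp add: min_def add_increasing)

lemma Phi_le_Q_obj: "Phi \<mu> x \<le> Q_obj \<mu> x \<omega>"
  unfolding Phi_def Q_obj_eq_sum by (intro sum_mono trunc_huber_le_coupling)

lemma Q_obj_H_op:
  assumes "\<mu> > 0"
  shows "Q_obj \<mu> x (H_op \<mu> x) = Phi \<mu> x"
  unfolding Phi_def Q_obj_eq_sum
proof (intro sum.cong refl)
  fix i
  have "(x $ i)\<^sup>2 / \<mu>\<^sup>2 \<le> 1 \<longleftrightarrow> \<bar>x $ i\<bar> \<le> \<mu>"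
    using assms by (simp add: abs_le_square_iff[symmetric])
  then have "trunc_huber \<mu> (x $ i) = (if \<bar>x $ i\<bar> \<le> \<mu> then (x $ i)\<^sup>2 / \<mu>\<^sup>2 else 1)"
    unfolding trunc_huber_def by (auto simp only: min_absorb2 min_absorb1 not_le split: if_splits)
  then show "((1 - H_op \<mu> x $ i) * x $ i)\<^sup>2 / \<mu>\<^sup>2 + (if H_op \<mu> x $ i \<noteq> 0 then 1 else 0)
      = trunc_huber \<mu> (x $ i)"
    by (simp add: H_op_def)
qed

lemma J_obj_H_op: "\<mu> > 0 \<Longrightarrow> J_obj A b \<alpha> \<mu> x (H_op \<mu> x) = G_obj A b \<alpha> \<mu> x"
  by (simp add: J_obj_def G_obj_def Q_obj_H_op)

lemma G_obj_le_J_obj: "G_obj A b \<alpha> \<mu> x \<le> J_obj A b \<alpha> \<mu> x \<omega>"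
  by (simp add: J_obj_def G_obj_def Phi_le_Q_obj)

lemma binary_H_op: "binary_vec (H_op \<mu> x)"
  by (simp add: binary_vec_def H_op_def)

lemma norm0_le_J_obj: "\<alpha> \<ge> 0 \<Longrightarrow> real (norm0 \<omega>) \<le> J_obj A b \<alpha> \<mu> x \<omega>"
  by (simp add: J_obj_def Q_obj_def)

section \<open>Fixed points are strict local minimizers\<close>

text \<open>
  Although the counting term is discontinuous, it only jumps upwards near \<open>\<omega>\<close>.  A larger support
  costs at least \<open>1\<close>, more than the continuous rest \<open>C\<close> can lose nearby.  With equal supports,
  replacing \<open>v\<close> by \<open>\<omega>\<close> does not increase the coupling term, which reduces the comparison to
  minimality in \<open>x\<close>; when \<open>u = x\<close>, an entry of \<open>v\<close> has moved away from \<open>1\<close> where \<open>x\<close> is nonzero.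
\<close>

lemma J_obj_strict_local_minimizer:
  fixes A :: "real ^ 'n ^ 'm"
  assumes "\<mu> > 0" and bin: "binary_vec \<omega>"
    and nz: "\<And>i. \<omega> $ i = 1 \<Longrightarrow> x $ i \<noteq> 0"
    and min: "\<And>u. u \<noteq> x \<Longrightarrow> J_obj A b \<alpha> \<mu> x \<omega> < J_obj A b \<alpha> \<mu> u \<omega>"
  shows "strict_local_minimizer (\<lambda>(u, v). J_obj A b \<alpha> \<mu> u v) (x, \<omega>)"
proof -
  have w: "\<omega> $ i = 0 \<or> \<omega> $ i = 1" for i using bin by (simp add: binary_vec_def)
  define S where "S = {i. \<omega> $ i \<noteq> 0}"
  define T :: "(real ^ 'n) \<Rightarrow> 'n set" where "T v = {i. v $ i \<noteq> 0}" for v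
  define C where "C z = \<alpha> / 2 * (norm (A *v fst z - b))\<^sup>2
      + 1 / \<mu>\<^sup>2 * (norm ((1 - snd z) * fst z))\<^sup>2" for z :: "(real ^ 'n) \<times> (real ^ 'n)"
  have J: "J_obj A b \<alpha> \<mu> (fst z) (snd z) = C z + real (card (T (snd z)))" for z
    by (simp add: J_obj_def Q_obj_def C_def norm0_def T_def)
  \<comment> \<open>Writing the entrywise product in coordinates gives access to the continuity rules.\<close>
  have "(1 - snd z) * fst z = (\<chi> i. (1 - snd z $ i) * fst z $ i)"
    for z :: "(real ^ 'n) \<times> (real ^ 'n)"
    by (simp add: vec_eq_iff)
  then have "continuous_on UNIV (\<lambda>z :: (real ^ 'n) \<times> (real ^ 'n). (1 - snd z) * fst z)"
    by (simp only:) (intro continuous_intros continuous_on_vec_lambda)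
  moreover have "continuous_on UNIV (\<lambda>z :: (real ^ 'n) \<times> (real ^ 'n). A *v fst z)"
    by (intro bounded_linear.continuous_on[OF matrix_vector_mul_bounded_linear] continuous_intros)
  ultimately have "continuous_on UNIV C"
    unfolding C_def by (intro continuous_intros)
  then have "(C \<longlongrightarrow> C (x, \<omega>)) (at (x, \<omega>))"
    by (simp add: continuous_on_def)
  then have evC: "\<forall>\<^sub>F z in at (x, \<omega>). C (x, \<omega>) - 1 < C z"
    by (rule order_tendstoD) simp
  have "\<forall>\<^sub>F z in at (x, \<omega>). snd z $ i \<noteq> 0" if "i \<in> S" for i
  proof (rule tendsto_imp_eventually_ne)
    show "((\<lambda>z. snd z $ i) \<longlongrightarrow> \<omega> $ i) (at (x, \<omega>))"
      using tendsto_vec_nth[OF tendsto_snd[OF tendsto_ident_at]] by fastforce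
    show "\<omega> $ i \<noteq> 0" using that by (simp add: S_def)
  qed
  then have evS: "\<forall>\<^sub>F z in at (x, \<omega>). \<forall>i\<in>S. snd z $ i \<noteq> 0"
    by (simp add: eventually_ball_finite)
  have increase: "J_obj A b \<alpha> \<mu> x \<omega> < J_obj A b \<alpha> \<mu> (fst z) (snd z)"
    if near: "C (x, \<omega>) - 1 < C z" "\<forall>i\<in>S. snd z $ i \<noteq> 0" and ne: "z \<noteq> (x, \<omega>)" for z
  proof (cases "T (snd z) = S")
    case False
    with near(2) have "S \<subset> T (snd z)" by (auto simp: T_def)
    then have "card S < card (T (snd z))" by (simp add: psubset_card_mono)
    moreover have "T \<omega> = S" by (simp add: T_def S_def)
    ultimately show ?thesis
      using J[of "(x, \<omega>)"] J[of z] near(1) by simp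
  next
    case True
    obtain u v where z: "z = (u, v)" by (cases z)
    have v0: "v $ i = 0 \<longleftrightarrow> \<omega> $ i = 0" for i using True by (auto simp: z T_def S_def)
    have term_le: "((1 - \<omega> $ i) * u $ i)\<^sup>2 / \<mu>\<^sup>2 + (if \<omega> $ i \<noteq> 0 then 1 else 0)
        \<le> ((1 - v $ i) * u $ i)\<^sup>2 / \<mu>\<^sup>2 + (if v $ i \<noteq> 0 then 1 else 0)" for i
      using w[of i] v0[of i] by auto
    then have le: "Q_obj \<mu> u \<omega> \<le> Q_obj \<mu> u v"
      unfolding Q_obj_eq_sum by (intro sum_mono)
    show ?thesis
    proof (cases "u = x")
      case False
      have "J_obj A b \<alpha> \<mu> u \<omega> \<le> J_obj A b \<alpha> \<mu> u v"
        using le by (simp add: J_obj_def)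
      with min[OF False] show ?thesis by (simp add: z)
    next
      case u: True
      with ne z obtain i where i: "v $ i \<noteq> \<omega> $ i" by (auto simp: vec_eq_iff)
      with v0[of i] w[of i] have "\<omega> $ i = 1" "v $ i \<noteq> 0" by auto
      with i nz[of i] assms(1) have "((1 - \<omega> $ i) * u $ i)\<^sup>2 / \<mu>\<^sup>2 + (if \<omega> $ i \<noteq> 0 then 1 else 0)
        < ((1 - v $ i) * u $ i)\<^sup>2 / \<mu>\<^sup>2 + (if v $ i \<noteq> 0 then 1 else 0)"
        by (simp add: u)
      then have "Q_obj \<mu> u \<omega> < Q_obj \<mu> u v"
        unfolding Q_obj_eq_sum using term_le
        by (intro sum_strict_mono_ex1) (rule finite, simp, blast)
      then show ?thesis by (simp add: J_obj_def z u)
    qed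
  qed
  show ?thesis
    unfolding strict_local_minimizer_def
    using evC evS eventually_neq_at_within[of "(x, \<omega>)" "(x, \<omega>)" UNIV]
  proof eventually_elim
    case (elim z)
    then show ?case using increase[of z] by (simp add: split_beta)
  qed
qed

lemma H_op_locally_constant:
  assumes "\<And>i. \<bar>x $ i\<bar> \<noteq> \<mu>"
  shows "\<forall>\<^sub>F u in at x. H_op \<mu> u = H_op \<mu> x"
proof -
  have "\<forall>\<^sub>F u in at x. \<bar>u $ i\<bar> \<le> \<mu> \<longleftrightarrow> \<bar>x $ i\<bar> \<le> \<mu>" for i
  proof -
    have lim: "((\<lambda>u. \<bar>u $ i\<bar>) \<longlongrightarrow> \<bar>x $ i\<bar>) (at x)"
      by (intro tendsto_intros)
    show ?thesis
    proof (cases "\<bar>x $ i\<bar> < \<mu>")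
      case True
      with order_tendstoD(2)[OF lim True] show ?thesis by (auto elim: eventually_mono)
    next
      case False
      with assms[of i] have "\<mu> < \<bar>x $ i\<bar>" by simp
      with order_tendstoD(1)[OF lim this] show ?thesis by (auto elim: eventually_mono)
    qed
  qed
  then have "\<forall>\<^sub>F u in at x. \<forall>i. \<bar>u $ i\<bar> \<le> \<mu> \<longleftrightarrow> \<bar>x $ i\<bar> \<le> \<mu>"
    by (rule eventually_all_finite)
  then show ?thesis
    by eventually_elim (simp add: H_op_def)
qed

lemma fixed_point_model_minimizer:
  fixes A :: "real ^ 'n ^ 'm"
  assumes "\<alpha> > 0" "\<mu> > 0" "norm0 \<omega> < spark A"
    and x: "x = bcd_x_update A b \<alpha> \<mu> \<omega>" and w: "\<omega> = H_op \<mu> x"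
  shows "model_minimizer A b \<alpha> \<mu> x \<omega>"
proof -
  have bin: "binary_vec \<omega>" by (simp add: w binary_H_op)
  have min: "J_obj A b \<alpha> \<mu> x \<omega> < J_obj A b \<alpha> \<mu> u \<omega>" if "u \<noteq> x" for u
    using bcd_x_update_minimizes[OF assms(1,2) bin assms(3)] that x by simp
  have G: "G_obj A b \<alpha> \<mu> x = J_obj A b \<alpha> \<mu> x \<omega>"
    using assms(2) w J_obj_H_op by metis
  have "strict_local_minimizer (\<lambda>(u, v). J_obj A b \<alpha> \<mu> u v) (x, \<omega>)"
  proof (rule J_obj_strict_local_minimizer[OF assms(2) bin _ min])
    fix i assume "\<omega> $ i = 1"
    then have "\<mu> < \<bar>x $ i\<bar>" by (subst (asm) w) (simp add: H_op_def split: if_splits)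
    with assms(2) show "x $ i \<noteq> 0" by auto
  qed
  moreover have "is_arg_min (\<lambda>u. J_obj A b \<alpha> \<mu> u \<omega>) (\<lambda>_. True) x"
    unfolding is_arg_min_def using min by (metis less_asym)
  moreover have "is_arg_min (\<lambda>v. J_obj A b \<alpha> \<mu> x v) (\<lambda>_. True) \<omega>"
    unfolding is_arg_min_def using G_obj_le_J_obj[of A b \<alpha> \<mu> x] by (simp add: not_less flip: G)
  moreover have "strict_local_minimizer (G_obj A b \<alpha> \<mu>) x" if "\<forall>i. \<bar>x $ i\<bar> \<noteq> \<mu>"
  proof -
    have "\<forall>\<^sub>F u in at x. H_op \<mu> u = \<omega>"
      using H_op_locally_constant[of x \<mu>] that by (simp flip: w)
    then show ?thesis
      unfolding strict_local_minimizer_def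
      using eventually_neq_at_within[of x x UNIV]
    proof eventually_elim
      case (elim u)
      then show ?case
        using min[of u] J_obj_H_op[OF assms(2), of A b \<alpha> u] by (simp add: G)
    qed
  qed
  ultimately show ?thesis
    using G by (simp add: model_minimizer_def)
qed

section \<open>Finite termination\<close>

lemma decseq_finite_range_repeats:
  fixes f :: "nat \<Rightarrow> 'a::linorder"
  assumes "\<And>k. f (Suc k) \<le> f k" and "finite (range f)"
  shows "\<exists>k. f (Suc k) = f k"
proof (rule ccontr)
  assume "\<not> ?thesis"
  then have strict: "f (Suc k) < f k" for k using assms(1)[of k] by (simp add: order_less_le)
  have "f n < f m" if "m < n" for m n
    using that
  proof (induction rule: less_Suc_induct)
    case 1
    show ?case by (rule strict)
  next
    case 2
    then show ?case by order
  qed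
  then have "inj f" by (metis injI less_irrefl linorder_neqE_nat)
  with assms(2) show False using finite_imageD infinite_UNIV_nat by blast
qed

lemma finite_binary_vec: "finite {\<omega> :: real ^ 'n. binary_vec \<omega>}"
proof (rule finite_subset)
  show "{\<omega> :: real ^ 'n. binary_vec \<omega>} \<subseteq> (\<lambda>I. \<chi> i. if i \<in> I then 1 else 0) ` UNIV"
  proof
    fix \<omega> :: "real ^ 'n" assume "\<omega> \<in> {\<omega>. binary_vec \<omega>}"
    then have "\<omega> = (\<chi> i. if i \<in> {i. \<omega> $ i = 1} then 1 else 0)"
      by (auto simp: binary_vec_def vec_eq_iff)
    then show "\<omega> \<in> (\<lambda>I. \<chi> i. if i \<in> I then 1 else 0) ` UNIV" by blast
  qed
qed simp

lemma bcd_seq_Suc: "bcd_seq A b \<alpha> \<mu> z0 (Suc k) = bcd_step A b \<alpha> \<mu> (bcd_seq A b \<alpha> \<mu> z0 k)"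
  by (simp add: bcd_seq_def)

theorem theorem3p4:
  fixes A :: "real ^ 'n ^ 'm" and b :: "real ^ 'm" and \<alpha> \<mu> :: real
    and x0 \<omega>0 :: "real ^ 'n"
  assumes "CARD('m) < CARD('n)"
    and "b \<noteq> 0"
    and "\<alpha> > 0"
    and "\<mu> > 0"
    and "binary_vec \<omega>0"
    and "J_obj A b \<alpha> \<mu> x0 \<omega>0 < real (spark A)"
  shows "bounded (range (bcd_seq A b \<alpha> \<mu> (x0, \<omega>0))) \<and>
    (\<exists>xs \<omega>s. bcd_seq A b \<alpha> \<mu> (x0, \<omega>0) \<longlonglongrightarrow> (xs, \<omega>s)
       \<and> (\<exists>N. \<forall>k\<ge>N. bcd_seq A b \<alpha> \<mu> (x0, \<omega>0) k = (xs, \<omega>s))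
       \<and> model_minimizer A b \<alpha> \<mu> xs \<omega>s)"
proof -
  note pos = assms(3,4)
  define s where "s = bcd_seq A b \<alpha> \<mu> (x0, \<omega>0)"
  define X W where "X k = fst (s k)" and "W k = snd (s k)" for k
  define J where "J = J_obj A b \<alpha> \<mu>"
  define upd where "upd = bcd_x_update A b \<alpha> \<mu>"
  have s: "s k = (X k, W k)" for k by (simp add: X_def W_def)
  have X_Suc: "X (Suc k) = upd (W k)" and W_Suc: "W (Suc k) = H_op \<mu> (X (Suc k))" for k
    by (simp_all add: X_def W_def s_def upd_def bcd_seq_Suc bcd_step_def Let_def)
  have s0: "X 0 = x0" "W 0 = \<omega>0"
    by (simp_all add: X_def W_def s_def bcd_seq_def)
  have bin: "binary_vec (W k)" for k
    by (cases k) (simp_all add: s0 assms(5) W_Suc binary_H_op)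
  have W_step: "J (X (Suc k)) (W (Suc k)) \<le> J (X (Suc k)) (W k)" for k
    using J_obj_H_op[OF pos(2)] G_obj_le_J_obj by (metis J_def W_Suc)
  have sparse: "norm0 (W k) < spark A" if "J (X k) (W k) < spark A" for k
    using that norm0_le_J_obj[of \<alpha> "W k" A b \<mu> "X k"] pos by (simp add: J_def)
  have X_step: "J (X (Suc k)) (W k) < J u (W k)"
    if "J (X k) (W k) < spark A" "u \<noteq> X (Suc k)" for k u
    using bcd_x_update_minimizes[OF pos bin sparse[OF that(1)]] that(2)
    by (simp add: J_def X_Suc upd_def)
  \<comment> \<open>Decrease in the x-block rests on this bound, so the bound is propagated step by step.\<close>
  have below: "J (X k) (W k) < spark A" for k
  proof (induction k)
    case 0
    then show ?case using assms(6) by (simp add: J_def s0)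
  next
    case (Suc k)
    have "J (X (Suc k)) (W k) \<le> J (X k) (W k)"
      using X_step[OF Suc, of "X k"] by (cases "X k = X (Suc k)") auto
    with W_step[of k] Suc show ?case by linarith
  qed
  \<comment> \<open>The minimum of \<open>J\<close> over the x-block: it depends on the binary vector \<open>W k\<close> alone, and strictly
    drops as long as the minimizing x-block changes.\<close>
  define F where "F k = J (X (Suc k)) (W k)" for k
  have "finite (range F)"
  proof (rule finite_subset)
    show "range F \<subseteq> (\<lambda>\<omega>. J (upd \<omega>) \<omega>) ` {\<omega>. binary_vec \<omega>}"
      by (auto simp: F_def X_Suc bin)
  qed (simp add: finite_binary_vec)
  moreover have F_step: "F (Suc k) < F k" if "X (Suc k) \<noteq> X (Suc (Suc k))" for k
    using X_step[OF below that] W_step[of k] by (simp add: F_def)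
  moreover have "F (Suc k) \<le> F k" for k
    using F_step[of k] W_step[of k] by (cases "X (Suc k) = X (Suc (Suc k))") (auto simp: F_def)
  ultimately obtain k where "F (Suc k) = F k"
    using decseq_finite_range_repeats by blast
  then have X_fix: "X (Suc (Suc k)) = X (Suc k)"
    using F_step[of k] by fastforce
  then have s_fix: "bcd_step A b \<alpha> \<mu> (s (Suc k)) = s (Suc k)"
    by (metis W_Suc bcd_seq_Suc s s_def)
  have const: "s n = s (Suc k)" if "n \<ge> Suc k" for n
    using that
  proof (induction n rule: dec_induct)
    case (step n)
    then show ?case using s_fix by (simp add: s_def bcd_seq_Suc)
  qed simp
  have lim: "s \<longlonglongrightarrow> s (Suc k)"
    by (rule tendsto_eventually) (auto simp: eventually_sequentially intro: const)
  have "model_minimizer A b \<alpha> \<mu> (X (Suc k)) (W (Suc k))"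
    using X_fix X_Suc[of "Suc k"]
    by (intro fixed_point_model_minimizer[OF pos sparse[OF below] _ W_Suc]) (simp add: upd_def)
  with lim const convergent_imp_bounded[OF lim] show ?thesis
    unfolding s_def[symmetric] s[of "Suc k"] by blast
qed

end
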